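(* Let $G$ be a finite simple connected undirected graph on $V=\{1,\dots,n\}$ with $m$ edges, every vertex of degree at least $2$, and $G$ not a cycle, and suppose the NBRW on $G$ has locally uniform return time. Then \[ M^{(nb)}_v=J-Z^{(nb)}_vR+W_vM^{(nb)}_v . \] In particular, writing $m_{ij}=(M^{(nb)}_v)_{ij}$ and $z_{ij}=(Z^{(nb)}_v)_{ij}$, for all $i,j\in V$, \[ m_{ij}=\frac{z_{jj}-z_{ij}}{\pi_j}. \]
   Context: $d_i=\deg(i)$, $D=\mathrm{diag}(d_i)$, $J$ the $n\times n$ all-ones matrix. Directed edges: the $2m$ ordered pairs $(i,j)$ with $\{i,j\}$ an edge. $P_{nb}((i,j),(k,\ell))=\frac1{d_j-1}$ if $j=k,\ell\ne i$, else $0$. $T$ ($n\times2m$): $T(x,(i,j))=1$ iff $i=x$. $\pi_i=d_i/(2m)$, $\pi_e=\frac1{2m}\mathbb 1\in\mathbb R^{2m}$, $W_v=\mathbb 1\pi^\top$, $W_e=\mathbb 1\pi_e^\top$. $Z^{(nb)}_e=(I-P_{nb}+W_e)^{-1}$, $Z^{(nb)}_v=D^{-1}TZ^{(nb)}_eT^\top$. NBRW on vertices: $\tilde X_1$ uniform neighbor of $\tilde X_0$; for $k\ge1$, $\tilde X_{k+1}$ uniform among neighbors of $\tilde X_k$ other than $\tilde X_{k-1}$. $\tilde T_v=\min\{k\ge0:\tilde X_k=v\}$, $\tilde T^+_v=\min\{k\ge1:\tilde X_k=v\}$. $M^{(nb)}_v$ is the $n\times n$ matrix with $(i,j)$ entry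 $\mathbb E[\tilde T_j\mid\tilde X_0=i]$ (so zero diagonal). $R=\mathrm{diag}(\mathbb E[\tilde T_i^+\mid\tilde X_0=i])$. Locally uniform return time: for every vertex $i$, $\mathbb E[\tilde T_i^+\mid\tilde X_0=i,\tilde X_1=j]$ is independent of the neighbor $j$. *)

theory Defs
  imports "HOL-Probability.Probability"
begin

text \<open>
  A finite graph is an adjacency relation \<open>E\<close> on a vertex type of class \<^class>\<open>finite\<close>.
\<close>

definition simple_graph :: "('v \<Rightarrow> 'v \<Rightarrow> bool) \<Rightarrow> bool" where
  "simple_graph E \<longleftrightarrow> symp E \<and> irreflp E"

definition connected_graph :: "('v \<Rightarrow> 'v \<Rightarrow> bool) \<Rightarrow> bool" where
  "connected_graph E \<longleftrightarrow> (\<forall>i j. E\<^sup>*\<^sup>* i j)"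

definition nbrs :: "('v \<Rightarrow> 'v \<Rightarrow> bool) \<Rightarrow> 'v \<Rightarrow> 'v set" where
  "nbrs E i = {j. E i j}"

definition deg :: "('v \<Rightarrow> 'v \<Rightarrow> bool) \<Rightarrow> 'v \<Rightarrow> nat" where
  "deg E i = card (nbrs E i)"

definition num_edges :: "('v \<Rightarrow> 'v \<Rightarrow> bool) \<Rightarrow> nat" where
  "num_edges E = card {{i, j} | i j. E i j}"

definition directed_edges :: "('v \<Rightarrow> 'v \<Rightarrow> bool) \<Rightarrow> ('v \<times> 'v) set" where
  "directed_edges E = {(i, j). E i j}"

definition is_cycle_graph :: "('v \<Rightarrow> 'v \<Rightarrow> bool) \<Rightarrow> bool" where
  "is_cycle_graph E \<longleftrightarrow>
     (\<exists>(n::nat) f. n \<ge> 3 \<and> bij_betw f {..<n} UNIV \<and>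
        (\<forall>a<n. \<forall>b<n. E (f a) (f b) \<longleftrightarrow> b = (a + 1) mod n \<or> a = (b + 1) mod n))"

text \<open>
  Law of the non-backtracking random walk started at \<open>x\<close>, as a measure on trajectories
  \<open>nat \<Rightarrow> 'v\<close>: \<open>nbrw_step E x k \<omega>\<close> is the conditional distribution of the position at time \<open>k\<close>
  given the positions \<open>\<omega> 0, \<dots>, \<omega> (k - 1)\<close>, and the Ionescu-Tulcea theorem glues these kernels.
\<close>

fun nbrw_step :: "('v \<Rightarrow> 'v \<Rightarrow> bool) \<Rightarrow> 'v \<Rightarrow> nat \<Rightarrow> (nat \<Rightarrow> 'v) \<Rightarrow> 'v pmf" where
  "nbrw_step E x 0 \<omega> = return_pmf x"
| "nbrw_step E x (Suc 0) \<omega> = pmf_of_set (nbrs E (\<omega> 0))"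
| "nbrw_step E x (Suc (Suc k)) \<omega> = pmf_of_set (nbrs E (\<omega> (Suc k)) - {\<omega> k})"

definition nbrw :: "('v::finite \<Rightarrow> 'v \<Rightarrow> bool) \<Rightarrow> 'v \<Rightarrow> (nat \<Rightarrow> 'v) measure" where
  "nbrw E x =
     projective_family.lim UNIV
       (Ionescu_Tulcea.CI (\<lambda>k \<omega>. measure_pmf (nbrw_step E x k \<omega>)) (\<lambda>_. count_space UNIV))
       (\<lambda>_. count_space UNIV)"

lemma Ionescu_Tulcea_nbrw:
  fixes E :: "'v::finite \<Rightarrow> 'v \<Rightarrow> bool"
  shows "Ionescu_Tulcea (\<lambda>k \<omega>. measure_pmf (nbrw_step E x k \<omega>)) (\<lambda>_. count_space UNIV)"
proof
  fix i :: nat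
  have "PiM {0..<i} (\<lambda>_. count_space (UNIV :: 'v set)) = count_space (PiE {0..<i} (\<lambda>_. UNIV))"
    by (rule count_space_PiM_finite) (auto intro: countable_finite)
  then show "(\<lambda>\<omega>. measure_pmf (nbrw_step E x i \<omega>))
      \<in> measurable (PiM {0..<i} (\<lambda>_. count_space UNIV)) (subprob_algebra (count_space UNIV))"
    by (auto simp: measurable_count_space_eq1 space_subprob_algebra
        intro: prob_space_imp_subprob_space measure_pmf.prob_space_axioms)
qed

lemma sets_nbrw: "sets (nbrw E x) = sets (PiM UNIV (\<lambda>_. count_space UNIV))"
proof -
  interpret Ionescu_Tulcea "\<lambda>k \<omega>. measure_pmf (nbrw_step E x k \<omega>)" "\<lambda>_. count_space UNIV"
    by (rule Ionescu_Tulcea_nbrw)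
  show ?thesis by (simp add: nbrw_def)
qed

lemma prob_space_nbrw: "prob_space (nbrw E x)"
proof
  interpret Ionescu_Tulcea "\<lambda>k \<omega>. measure_pmf (nbrw_step E x k \<omega>)" "\<lambda>_. count_space UNIV"
    by (rule Ionescu_Tulcea_nbrw)
  interpret prob_space "CI {}" by (rule PF.prob_space_P) auto
  have "prod_emb UNIV (\<lambda>_. count_space UNIV) {} {\<lambda>_. undefined} = space (nbrw E x)"
    using sets_eq_imp_space_eq[OF sets_nbrw[of E x]] by (auto simp: prod_emb_def space_PiM)
  moreover have "emeasure (CI {}) {\<lambda>_. undefined} = 1"
    using emeasure_space_1 by (simp add: CI_def space_PiM)
  ultimately show "emeasure (nbrw E x) (space (nbrw E x)) = 1"
    using lim[of "{}" "{\<lambda>_. undefined}"] by (simp add: nbrw_def sets_PiM_empty)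
qed

text \<open>\<open>\<infinity>\<close> when the vertex is never reached, as the infimum of the empty set.\<close>

definition hitting_time :: "'v \<Rightarrow> (nat \<Rightarrow> 'v) \<Rightarrow> enat" where
  "hitting_time v \<omega> = Inf {enat k | k. \<omega> k = v}"

definition return_time :: "'v \<Rightarrow> (nat \<Rightarrow> 'v) \<Rightarrow> enat" where
  "return_time v \<omega> = Inf {enat k | k. k \<ge> 1 \<and> \<omega> k = v}"

definition expected_hitting_time :: "('v::finite \<Rightarrow> 'v \<Rightarrow> bool) \<Rightarrow> 'v \<Rightarrow> 'v \<Rightarrow> ennreal" where
  "expected_hitting_time E i j = (\<integral>\<^sup>+ \<omega>. ennreal_of_enat (hitting_time j \<omega>) \<partial>nbrw E i)"

definition expected_return_time :: "('v::finite \<Rightarrow> 'v \<Rightarrow> bool) \<Rightarrow> 'v \<Rightarrow> ennreal" where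
  "expected_return_time E i = (\<integral>\<^sup>+ \<omega>. ennreal_of_enat (return_time i \<omega>) \<partial>nbrw E i)"

definition expected_return_time_via :: "('v::finite \<Rightarrow> 'v \<Rightarrow> bool) \<Rightarrow> 'v \<Rightarrow> 'v \<Rightarrow> ennreal" where
  "expected_return_time_via E i j =
     (\<integral>\<^sup>+ \<omega>. ennreal_of_enat (return_time i \<omega>)
        \<partial>uniform_measure (nbrw E i) {\<omega> \<in> space (nbrw E i). \<omega> 1 = j})"

definition locally_uniform_return_time :: "('v::finite \<Rightarrow> 'v \<Rightarrow> bool) \<Rightarrow> bool" where
  "locally_uniform_return_time E \<longleftrightarrow>
     (\<forall>i. \<forall>j\<in>nbrs E i. \<forall>k\<in>nbrs E i. expected_return_time_via E i j = expected_return_time_via E i k)"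

definition hitting_matrix :: "('v::finite \<Rightarrow> 'v \<Rightarrow> bool) \<Rightarrow> real^'v^'v" where
  "hitting_matrix E = (\<chi> i j. enn2real (expected_hitting_time E i j))"

definition return_matrix :: "('v::finite \<Rightarrow> 'v \<Rightarrow> bool) \<Rightarrow> real^'v^'v" where
  "return_matrix E = (\<chi> i j. if i = j then enn2real (expected_return_time E i) else 0)"

definition all_ones :: "real^'v^'v" where
  "all_ones = (\<chi> i j. 1)"

definition degree_matrix :: "('v::finite \<Rightarrow> 'v \<Rightarrow> bool) \<Rightarrow> real^'v^'v" where
  "degree_matrix E = (\<chi> i j. if i = j then real (deg E i) else 0)"

definition stat_v :: "('v::finite \<Rightarrow> 'v \<Rightarrow> bool) \<Rightarrow> real^'v" where
  "stat_v E = (\<chi> i. real (deg E i) / (2 * real (num_edges E)))"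

definition W_v :: "('v::finite \<Rightarrow> 'v \<Rightarrow> bool) \<Rightarrow> real^'v^'v" where
  "W_v E = (\<chi> i j. stat_v E $ j)"

text \<open>
  The number of directed edges depends on the graph, so matrices over directed edges are
  indexed by a finite type \<open>'e\<close> together with a labelling \<open>dedge\<close>, in use always a bijection
  from \<open>'e\<close> onto \<^const>\<open>directed_edges\<close>.
\<close>

definition P_nb :: "('v \<Rightarrow> 'v \<Rightarrow> bool) \<Rightarrow> ('e::finite \<Rightarrow> 'v \<times> 'v) \<Rightarrow> real^'e^'e" where
  "P_nb E dedge =
     (\<chi> e f. case (dedge e, dedge f) of ((i, j), (k, l)) \<Rightarrow>
        if j = k \<and> l \<noteq> i then 1 / (real (deg E j) - 1) else 0)"

definition T_mat :: "('e::finite \<Rightarrow> 'v::finite \<times> 'v) \<Rightarrow> real^'e^'v" where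
  "T_mat dedge = (\<chi> x e. if fst (dedge e) = x then 1 else 0)"

definition stat_e :: "('v \<Rightarrow> 'v \<Rightarrow> bool) \<Rightarrow> real^'e::finite" where
  "stat_e E = (\<chi> e. 1 / (2 * real (num_edges E)))"

definition W_e :: "('v \<Rightarrow> 'v \<Rightarrow> bool) \<Rightarrow> real^'e^'e::finite" where
  "W_e E = (\<chi> e f. stat_e E $ f)"

definition Z_e :: "('v \<Rightarrow> 'v \<Rightarrow> bool) \<Rightarrow> ('e::finite \<Rightarrow> 'v \<times> 'v) \<Rightarrow> real^'e^'e" where
  "Z_e E dedge = matrix_inv (mat 1 - P_nb E dedge + W_e E)"

definition Z_v :: "('v::finite \<Rightarrow> 'v \<Rightarrow> bool) \<Rightarrow> ('e::finite \<Rightarrow> 'v \<times> 'v) \<Rightarrow> real^'v^'v" where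
  "Z_v E dedge = matrix_inv (degree_matrix E) ** T_mat dedge ** Z_e E dedge ** transpose (T_mat dedge)"

end

theory Submission
  imports Defs
begin

text \<open>
  Fix a target \<open>j\<close> and let \<open>h\<close> assign to a directed edge \<open>(a, b)\<close> the expected time to hit \<open>j\<close> for the
  walk that starts at \<open>a\<close> and steps to \<open>b\<close>. First-step analysis and local uniformity give
  \<open>(I - P) h = 1 - R\<^sub>j 1\<^bsub>{a = j}\<^esub>\<close> on directed edges. Averaging over directed edges yields
  \<open>R\<^sub>j \<pi>\<^sub>j = 1\<close>, adding the average of \<open>h\<close> and applying the fundamental matrix yields \<open>h\<close>, and averaging
  over the edges leaving a vertex yields the claim.

  Since \<open>P\<close> is doubly stochastic, a function \<open>f \<le> P f\<close> on directed edges is constant along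
  non-backtracking steps. In a connected graph that has minimum degree 2 and is not a cycle, some vertex
  has degree at least 3, and such a function is constant. This gives both the invertibility of
  \<open>I - P + W\<close> and the finiteness of the hitting times: the probability of avoiding \<open>j\<close> forever is
  such a function, and it vanishes on the edges that enter \<open>j\<close>.
\<close>

section \<open>Non-backtracking steps in graphs that are not cycles\<close>

lemma card_2_otherE:
  assumes "card S = 2" "x \<in> S"
  obtains y where "y \<noteq> x" "S = {x, y}"
  using assms unfolding card_2_iff by (metis insert_commute insertE singletonD)

lemma connected_graph_closed_set:
  assumes "connected_graph E" "x \<in> S" "\<And>a b. a \<in> S \<Longrightarrow> E a b \<Longrightarrow> b \<in> S"
  shows "S = UNIV"
proof -
  have "y \<in> S" for y
  proof -
    have "E\<^sup>*\<^sup>* x y" using assms(1) by (simp add: connected_graph_def)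
    then show ?thesis by induction (use assms in auto)
  qed
  then show ?thesis by auto
qed

text \<open>With two neighbours everywhere, a non-backtracking walk is forced by its first edge. Its
  first repeated vertex is its start, and the vertices met before form a set closed under adjacency,
  hence the whole graph.\<close>

lemma two_regular_imp_cycle_graph:
  fixes E :: "'v::finite \<Rightarrow> 'v \<Rightarrow> bool"
  assumes simple: "simple_graph E" and conn: "connected_graph E" and deg2: "\<And>i. deg E i = 2"
  shows "is_cycle_graph E"
proof -
  have sym: "E a b \<Longrightarrow> E b a" for a b
    using simple by (auto simp: simple_graph_def symp_def)
  have irr: "\<not> E a a" for a
    using simple by (auto simp: simple_graph_def irreflp_def)
  have two: "\<exists>c. c \<noteq> a \<and> nbrs E b = {a, c}" if "E a b" for a b
  proof -
    have "card (nbrs E b) = 2" "a \<in> nbrs E b"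
      using deg2[of b] sym[OF that] by (auto simp: deg_def nbrs_def)
    then show ?thesis by (rule card_2_otherE) blast
  qed
  define other where "other a b = (SOME c. c \<noteq> a \<and> nbrs E b = {a, c})" for a b
  have other: "other a b \<noteq> a" "nbrs E b = {a, other a b}" if "E a b" for a b
    using someI_ex[OF two[OF that]] by (auto simp: other_def)
  obtain x :: 'v where True by simp
  have "nbrs E x \<noteq> {}" using deg2[of x] by (auto simp: deg_def)
  then obtain y where xy: "E x y" by (auto simp: nbrs_def)
  \<comment> \<open>The state is a pair (previous, current), since both determine the next
    vertex.\<close>
  define w where "w k = ((\<lambda>(a, b). (b, other a b)) ^^ k) (x, y)" for k
  define f where "f k = fst (w k)" for k
  have w: "w k = (f k, f (Suc k))" for k
    by (cases "w k") (simp add: w_def f_def)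
  have f_Suc: "f (Suc (Suc k)) = other (f k) (f (Suc k))" for k
    using w[of k] w[of "Suc k"] by (simp add: w_def)
  have step: "E (f k) (f (Suc k))" for k
  proof (induction k)
    case 0
    then show ?case using xy by (simp add: w_def f_def)
  next
    case (Suc k)
    then show ?case using other(2)[of "f k" "f (Suc k)"] f_Suc[of k] by (auto simp: nbrs_def)
  qed
  have nb: "f (Suc (Suc k)) \<noteq> f k" and nbrs_f: "nbrs E (f (Suc k)) = {f k, f (Suc (Suc k))}" for k
    using other[OF step[of k]] f_Suc by auto
  have "\<not> inj_on f UNIV"
    using finite_imageD[of f "UNIV :: nat set"] finite by auto
  then obtain a0 b0 where "a0 < b0" "f a0 = f b0"
    by (auto simp: inj_on_def) (metis linorder_neqE_nat)
  then have ex: "\<exists>n. \<exists>a<n. f a = f n" by auto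
  define n where "n = (LEAST n. \<exists>a<n. f a = f n)"
  obtain a where a: "a < n" "f a = f n"
    using LeastI_ex[OF ex] unfolding n_def by blast
  have min: "f i \<noteq> f k" if "i < k" "k < n" for i k
    using not_less_Least[of k "\<lambda>n. \<exists>a<n. f a = f n"] that unfolding n_def by blast
  have inj: "inj_on f {..<n}"
    by (auto simp: inj_on_def) (metis min linorder_neqE_nat)
  \<comment> \<open>If \<open>a\<close> were positive, the vertex before the repetition would be a
    neighbour of \<open>f a\<close>, so \<open>f (a - 1)\<close> or \<open>f (a + 1)\<close>. The
    first is an earlier repetition; the second forces \<open>n = a + 2\<close>, which is
    backtracking.\<close>
  have "a = 0"
  proof (rule ccontr)
    assume "a \<noteq> 0"
    then obtain a' where a': "a = Suc a'" by (cases a) auto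
    obtain n' where n': "n = Suc n'" using a(1) by (cases n) auto
    have "f n' \<in> nbrs E (f a)" using step[of n'] a n' sym by (auto simp: nbrs_def)
    then have "f n' = f a' \<or> f n' = f (Suc a)" using nbrs_f[of a'] a' by auto
    moreover have "f n' \<noteq> f a'" using min[of a' n'] a a' n' by auto
    ultimately have eq: "f n' = f (Suc a)" by simp
    have "n' \<noteq> a" using step[of n'] a n' irr by auto
    then have "Suc a \<le> n'" using a n' by simp
    then have "n' = Suc a" using min[of "Suc a" n'] eq n' by (metis le_neq_implies_less lessI)
    then show False using nb[of a] a n' by simp
  qed
  with a have f0: "f n = f 0" and npos: "0 < n" by auto
  have n3: "n \<ge> 3"
  proof (rule ccontr)
    assume "\<not> n \<ge> 3"
    then have "n = 1 \<or> n = 2" using npos by auto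
    then show False using f0 nb[of 0] step[of 0] irr by (auto simp: numeral_2_eq_2)
  qed
  have mod_f: "f (Suc k mod n) = f (Suc k)" if "k < n" for k
    using that f0 by (cases "Suc k = n") auto
  \<comment> \<open>Writing the vertex as a successor modulo \<open>n\<close> names its predecessor.
    Only vertex 0 is not covered by \<open>nbrs_f\<close>: its neighbours are the last vertex and
    \<open>f 1\<close>, which differ because \<open>n \<ge> 3\<close>.\<close>
  have nbrs_cyc: "E (f (Suc k mod n)) b \<longleftrightarrow> b = f k \<or> b = f (Suc (Suc k mod n))" if "k < n" for k b
  proof (cases "Suc k = n")
    case False
    then show ?thesis using that nbrs_f[of k] by (auto simp: nbrs_def)
  next
    case True
    have "f 1 \<noteq> f k" using min[of 1 k] True n3 by auto
    moreover have "E (f 0) (f k)" "E (f 0) (f 1)"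
      using step[of k] True f0 sym step[of 0] by auto
    ultimately have "nbrs E (f 0) = {f k, f 1}"
      using two[of "f k" "f 0"] sym by (auto simp: nbrs_def)
    then show ?thesis using True by (auto simp: nbrs_def)
  qed
  have pred: "\<exists>k<n. a = Suc k mod n" if "a < n" for a
  proof (cases a)
    case 0
    then show ?thesis using n3 by (intro exI[of _ "n - 1"]) auto
  next
    case (Suc k)
    then show ?thesis using that by (intro exI[of _ k]) auto
  qed
  have "f ` {..<n} = UNIV"
  proof (rule connected_graph_closed_set[OF conn])
    show "f 0 \<in> f ` {..<n}" using npos by auto
    fix u v assume "u \<in> f ` {..<n}" "E u v"
    then obtain k where k: "k < n" "u = f (Suc k mod n)" using pred by blast
    then have "v = f k \<or> v = f (Suc (Suc k mod n))" using \<open>E u v\<close> nbrs_cyc by blast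
    then have "v = f k \<or> v = f (Suc (Suc k mod n) mod n)" using mod_f[of "Suc k mod n"] npos by auto
    then show "v \<in> f ` {..<n}" using k npos by auto
  qed
  with inj have bij: "bij_betw f {..<n} UNIV" by (simp add: bij_betw_def)
  have "E (f a) (f b) \<longleftrightarrow> b = (a + 1) mod n \<or> a = (b + 1) mod n" if "a < n" "b < n" for a b
  proof -
    obtain k where k: "k < n" "a = Suc k mod n" using pred[OF \<open>a < n\<close>] by blast
    have "E (f a) (f b) \<longleftrightarrow> f b = f k \<or> f b = f (Suc a mod n)"
      using nbrs_cyc[OF k(1)] k(2) mod_f[OF \<open>a < n\<close>] by simp
    also have "\<dots> \<longleftrightarrow> b = k \<or> b = Suc a mod n"
      using inj k that npos by (auto simp: inj_on_def)
    also have "b = k \<longleftrightarrow> a = Suc b mod n"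
      using k that by (auto simp: mod_Suc split: if_splits)
    finally show ?thesis by auto
  qed
  with bij n3 show ?thesis unfolding is_cycle_graph_def by blast
qed

lemma obtain_branching_vertex:
  fixes E :: "'v::finite \<Rightarrow> 'v \<Rightarrow> bool"
  assumes "simple_graph E" "connected_graph E" "\<forall>i. deg E i \<ge> 2" "\<not> is_cycle_graph E"
  obtains v where "deg E v \<ge> 3"
proof -
  obtain v where "deg E v \<noteq> 2" using two_regular_imp_cycle_graph[of E] assms by blast
  moreover have "deg E v \<ge> 2" using assms by blast
  ultimately show ?thesis using that[of v] by linarith
qed

text \<open>
  Around a vertex of degree at least 3 all incident directed edges get the same value, and this
  spreads to neighbouring vertices.
\<close>

lemma nb_invariant_constant:
  fixes x :: "'v::finite \<Rightarrow> 'v \<Rightarrow> 'a"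
  assumes graph: "simple_graph E" "connected_graph E" "\<forall>i. deg E i \<ge> 2" "\<not> is_cycle_graph E"
    and inv: "\<And>a b c. E a b \<Longrightarrow> E b c \<Longrightarrow> c \<noteq> a \<Longrightarrow> x a b = x b c"
  shows "\<exists>k. \<forall>a b. E a b \<longrightarrow> x a b = k"
proof -
  have sym: "E a b \<Longrightarrow> E b a" for a b
    using graph(1) by (auto simp: simple_graph_def symp_def)
  obtain v where v: "deg E v \<ge> 3" by (rule obtain_branching_vertex[OF graph])
  then have "nbrs E v \<noteq> {}" by (auto simp: deg_def)
  then obtain w where w: "E v w" by (auto simp: nbrs_def)
  define S where "S = {u. \<forall>b. E u b \<longrightarrow> x u b = x v w \<and> x b u = x v w}"
  have third: "\<exists>c. E v c \<and> c \<noteq> a \<and> c \<noteq> b" for a b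
  proof -
    have "\<not> nbrs E v \<subseteq> {a, b}"
      using v card_mono[of "{a, b}" "nbrs E v"] card_insert_le_m1[of 2 "{b}" a] by (auto simp: deg_def)
    then show ?thesis by (auto simp: nbrs_def)
  qed
  \<comment> \<open>With distinct neighbours \<open>a\<close>, \<open>b\<close>, \<open>c\<close> of
    \<open>v\<close>, the chain is \<open>x a v = x v b = x c v = x v a\<close>.\<close>
  have rev: "x a v = x v a" if a: "E v a" for a
  proof -
    obtain b where b: "E v b" "b \<noteq> a" using third[of a a] by auto
    obtain c where c: "E v c" "c \<noteq> a" "c \<noteq> b" using third[of a b] by auto
    show ?thesis using inv[of a v b] inv[of c v b] inv[of c v a] a b c sym by metis
  qed
  have "v \<in> S"
    unfolding S_def using rev w inv sym by (smt (verit, best) mem_Collect_eq)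
  moreover have "b \<in> S" if "a \<in> S" "E a b" for a b
  proof -
    have ab: "x a b = x v w" "x b a = x v w" using that by (auto simp: S_def)
    have "x b c = x v w \<and> x c b = x v w" if "E b c" for c
      using ab inv[of a b c] inv[of c b a] that \<open>E a b\<close> sym by (cases "c = a") auto
    then show ?thesis by (simp add: S_def)
  qed
  ultimately have "S = UNIV" by (rule connected_graph_closed_set[OF graph(2)])
  then show ?thesis by (auto simp: S_def)
qed

section \<open>The mean over non-backtracking steps and the probability of avoiding a vertex\<close>

text \<open>Being values of a \<open>pmf\<close>, the weights are nonnegative and sum to 1 for all
  \<open>a\<close> and \<open>b\<close>; their explicit form is tied to edges
  \<open>(a, b)\<close>.\<close>

definition nb_prob :: "('v \<Rightarrow> 'v \<Rightarrow> bool) \<Rightarrow> 'v \<Rightarrow> 'v \<Rightarrow> 'v \<Rightarrow> real" where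
  "nb_prob E a b c = pmf (pmf_of_set (nbrs E b - {a})) c"

text \<open>On directed edges this is the action of the transition matrix \<open>P_nb\<close> on
  functions.\<close>

definition nb_mean :: "('v::finite \<Rightarrow> 'v \<Rightarrow> bool) \<Rightarrow> ('v \<Rightarrow> 'v \<Rightarrow> real) \<Rightarrow> 'v \<Rightarrow> 'v \<Rightarrow> real" where
  "nb_mean E f a b = (\<Sum>c\<in>UNIV. nb_prob E a b c * f b c)"

text \<open>The \<open>n\<close> positions required to avoid \<open>j\<close> begin with \<open>b\<close>; the start \<open>a\<close> may be \<open>j\<close> itself.\<close>

fun avoid_prob :: "('v::finite \<Rightarrow> 'v \<Rightarrow> bool) \<Rightarrow> 'v \<Rightarrow> nat \<Rightarrow> 'v \<Rightarrow> 'v \<Rightarrow> real" where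
  "avoid_prob E j 0 a b = 1"
| "avoid_prob E j (Suc n) a b = (if b = j then 0 else nb_mean E (avoid_prob E j n) a b)"

text \<open>The tail-sum formula for an expectation: \<open>avoid_prob E j n a b\<close> is the
  probability that the first time \<open>k \<ge> 1\<close> at \<open>j\<close> exceeds
  \<open>n\<close>, given the first step \<open>(a, b)\<close>.\<close>

definition mean_return :: "('v::finite \<Rightarrow> 'v \<Rightarrow> bool) \<Rightarrow> 'v \<Rightarrow> 'v \<Rightarrow> 'v \<Rightarrow> real" where
  "mean_return E j a b = (\<Sum>n. avoid_prob E j n a b)"

lemma nb_prob_nonneg: "nb_prob E a b c \<ge> 0"
  by (simp add: nb_prob_def)

lemma sum_nb_prob: "(\<Sum>c\<in>UNIV. nb_prob E a b c) = 1" for E :: "'v::finite \<Rightarrow> 'v \<Rightarrow> bool"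
  by (simp add: nb_prob_def sum_pmf_eq_1)

lemma nb_mean_mono: "(\<And>c. f b c \<le> g b c) \<Longrightarrow> nb_mean E f a b \<le> nb_mean E g a b"
  by (auto simp: nb_mean_def intro!: sum_mono mult_left_mono nb_prob_nonneg)

lemma nb_mean_const: "nb_mean E (\<lambda>_ _. k) a b = k"
  by (simp add: nb_mean_def sum_nb_prob flip: sum_distrib_right)

lemma avoid_prob_nonneg: "0 \<le> avoid_prob E j n a b"
proof (induction n arbitrary: a b)
  case (Suc n)
  have "nb_mean E (\<lambda>_ _. 0) a b \<le> nb_mean E (avoid_prob E j n) a b"
    by (rule nb_mean_mono) (rule Suc)
  then show ?case by (simp add: nb_mean_const)
qed simp

lemma avoid_prob_le_1: "avoid_prob E j n a b \<le> 1"
proof (induction n arbitrary: a b)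
  case (Suc n)
  have "nb_mean E (avoid_prob E j n) a b \<le> nb_mean E (\<lambda>_ _. 1) a b"
    by (rule nb_mean_mono) (rule Suc)
  then show ?case by (simp add: nb_mean_const)
qed simp

lemma avoid_prob_antimono: "avoid_prob E j (Suc n) a b \<le> avoid_prob E j n a b"
proof (induction n arbitrary: a b)
  case 0
  then show ?case using avoid_prob_le_1[of E j "Suc 0" a b] by simp
next
  case (Suc n)
  show ?case using nb_mean_mono[of "avoid_prob E j (Suc n)" b "avoid_prob E j n" E a, OF Suc] by simp
qed

lemma avoid_prob_decseq: "decseq (\<lambda>n. avoid_prob E j n a b)"
  by (rule decseq_SucI) (rule avoid_prob_antimono)

section \<open>Stationarity of the uniform edge distribution and decay of the avoidance
  probabilities\<close>

locale nb_graph =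
  fixes E :: "'v::finite \<Rightarrow> 'v \<Rightarrow> bool"
  assumes simple: "simple_graph E" and conn: "connected_graph E"
    and min_deg: "\<forall>i. deg E i \<ge> 2" and not_cycle: "\<not> is_cycle_graph E"
begin

lemma edge_sym: "E a b \<Longrightarrow> E b a"
  using simple by (auto simp: simple_graph_def symp_def)

lemma nb_prob_edge:
  assumes "E a b"
  shows "nb_prob E a b c = (if E b c \<and> c \<noteq> a then 1 / (real (deg E b) - 1) else 0)"
proof -
  have card: "card (nbrs E b - {a}) = deg E b - 1"
    using edge_sym[OF assms] by (simp add: deg_def nbrs_def)
  moreover have deg: "deg E b \<ge> 2" using min_deg by blast
  ultimately have "nbrs E b - {a} \<noteq> {}" by fastforce
  then show ?thesis using deg card by (auto simp: nb_prob_def nbrs_def of_nat_diff)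
qed

text \<open>Column sums of the transition matrix: exactly \<open>deg E b - 1\<close> edges enter
  \<open>b\<close> from a vertex other than \<open>c\<close>, and each contributes the reciprocal of
  that number.\<close>

lemma sum_nb_prob_column:
  assumes "E b c"
  shows "(\<Sum>a\<in>nbrs E b. nb_prob E a b c) = 1"
proof -
  have deg: "deg E b \<ge> 2" using min_deg by blast
  have "(\<Sum>a\<in>nbrs E b. nb_prob E a b c) = (\<Sum>a\<in>nbrs E b. if c \<noteq> a then 1 / (real (deg E b) - 1) else 0)"
    using assms by (intro sum.cong) (auto simp: nbrs_def nb_prob_edge edge_sym)
  also have "\<dots> = (\<Sum>a\<in>nbrs E b - {c}. 1 / (real (deg E b) - 1))"
    by (rule sum.mono_neutral_cong_right) auto
  also have "\<dots> = real (card (nbrs E b - {c})) / (real (deg E b) - 1)" by simp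
  also have "card (nbrs E b - {c}) = deg E b - 1"
    using assms by (simp add: deg_def nbrs_def)
  finally show ?thesis using deg by (simp add: of_nat_diff)
qed

lemma sum_edges_out: "(\<Sum>(a, b)\<in>directed_edges E. f a b) = (\<Sum>a\<in>UNIV. \<Sum>b\<in>nbrs E a. f a b)"
  by (subst sum.Sigma) (auto simp: directed_edges_def nbrs_def intro!: sum.cong)

lemma sum_edges_in: "(\<Sum>(a, b)\<in>directed_edges E. f a b) = (\<Sum>b\<in>UNIV. \<Sum>a\<in>nbrs E b. f a b)"
proof -
  have "(\<Sum>(a, b)\<in>directed_edges E. f a b) = (\<Sum>(b, a)\<in>directed_edges E. f a b)"
    by (rule sum.reindex_bij_witness[of _ prod.swap prod.swap]) (auto simp: directed_edges_def edge_sym)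
  then show ?thesis by (simp add: sum_edges_out[of "\<lambda>b a. f a b"])
qed

lemma sum_edges_eq_0D:
  fixes g :: "'v \<Rightarrow> 'v \<Rightarrow> real"
  assumes nonneg: "\<And>a b. E a b \<Longrightarrow> 0 \<le> g a b" and zero: "(\<Sum>(a, b)\<in>directed_edges E. g a b) = 0" and "E a b"
  shows "g a b = 0"
proof -
  have "(\<Sum>(a, b)\<in>directed_edges E. g a b) = 0 \<longleftrightarrow> (\<forall>(a, b)\<in>directed_edges E. g a b = 0)"
    by (subst sum_nonneg_eq_0_iff) (auto simp: directed_edges_def intro: nonneg)
  then show ?thesis using zero \<open>E a b\<close> unfolding directed_edges_def by blast
qed

text \<open>Stationarity: at each middle vertex \<open>b\<close>, unit column sums turn the sum over
  edges entering \<open>b\<close> into the sum over edges leaving \<open>b\<close>.\<close>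

lemma sum_edges_nb_mean:
  "(\<Sum>(a, b)\<in>directed_edges E. nb_mean E f a b) = (\<Sum>(a, b)\<in>directed_edges E. f a b)"
proof -
  have "(\<Sum>a\<in>nbrs E b. nb_mean E f a b) = (\<Sum>c\<in>nbrs E b. f b c)" for b
  proof -
    have "(\<Sum>a\<in>nbrs E b. nb_mean E f a b) = (\<Sum>c\<in>UNIV. \<Sum>a\<in>nbrs E b. nb_prob E a b c * f b c)"
      unfolding nb_mean_def by (rule sum.swap)
    also have "\<dots> = (\<Sum>c\<in>UNIV. (\<Sum>a\<in>nbrs E b. nb_prob E a b c) * f b c)"
      by (simp add: sum_distrib_right)
    also have "\<dots> = (\<Sum>c\<in>nbrs E b. f b c)"
    proof (rule sum.mono_neutral_cong_right)
      show "\<forall>c\<in>UNIV - nbrs E b. (\<Sum>a\<in>nbrs E b. nb_prob E a b c) * f b c = 0"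
        by (auto simp: nbrs_def nb_prob_edge edge_sym intro!: sum.neutral)
      show "(\<Sum>a\<in>nbrs E b. nb_prob E a b c) * f b c = f b c" if "c \<in> nbrs E b" for c
        using sum_nb_prob_column[of b c] that by (simp add: nbrs_def)
    qed auto
    finally show ?thesis .
  qed
  then show ?thesis by (simp add: sum_edges_in[of "nb_mean E f"] sum_edges_out[of f])
qed

text \<open>
  Since the uniform distribution on directed edges is stationary, the subharmonic inequality is an
  equality, and then the total variance along non-backtracking steps vanishes.
\<close>

lemma nb_subharmonic_constant:
  assumes sub: "\<And>a b. E a b \<Longrightarrow> f a b \<le> nb_mean E f a b"
  shows "\<exists>k. \<forall>a b. E a b \<longrightarrow> f a b = k"
proof -
  let ?D = "directed_edges E"
  have "(\<Sum>(a, b)\<in>?D. nb_mean E f a b - f a b) = 0"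
    using sum_edges_nb_mean[of f] by (simp add: sum_subtractf case_prod_unfold)
  then have harm: "nb_mean E f a b = f a b" if "E a b" for a b
    using sum_edges_eq_0D[of "\<lambda>a b. nb_mean E f a b - f a b" a b] sub that by simp
  define V where "V a b = (\<Sum>c\<in>UNIV. nb_prob E a b c * (f b c - f a b)\<^sup>2)" for a b
  have V_nonneg: "V a b \<ge> 0" for a b
    by (auto simp: V_def intro!: sum_nonneg mult_nonneg_nonneg nb_prob_nonneg)
  have "V a b = nb_mean E (\<lambda>a b. (f a b)\<^sup>2) a b - (f a b)\<^sup>2" if "E a b" for a b
  proof -
    have "V a b = nb_mean E (\<lambda>a b. (f a b)\<^sup>2) a b - 2 * f a b * nb_mean E f a b
        + (f a b)\<^sup>2 * (\<Sum>c\<in>UNIV. nb_prob E a b c)"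
      unfolding V_def nb_mean_def sum_distrib_left sum_subtractf[symmetric] sum.distrib[symmetric]
      by (intro sum.cong) (auto simp: power2_eq_square algebra_simps)
    then show ?thesis by (simp add: harm[OF that] sum_nb_prob power2_eq_square)
  qed
  then have "(\<Sum>(a, b)\<in>?D. V a b) = (\<Sum>(a, b)\<in>?D. nb_mean E (\<lambda>a b. (f a b)\<^sup>2) a b - (f a b)\<^sup>2)"
    by (intro sum.cong) (auto simp: directed_edges_def)
  also have "\<dots> = 0"
    using sum_edges_nb_mean[of "\<lambda>a b. (f a b)\<^sup>2"] by (simp add: sum_subtractf case_prod_unfold)
  finally have "V a b = 0" if "E a b" for a b
    using sum_edges_eq_0D[of V] V_nonneg that by blast
  then have zero: "nb_prob E a b c * (f b c - f a b)\<^sup>2 = 0" if "E a b" for a b c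
    using sum_nonneg_eq_0_iff[of UNIV "\<lambda>c. nb_prob E a b c * (f b c - f a b)\<^sup>2"] that
    unfolding V_def by (auto simp: nb_prob_nonneg)
  have "f a b = f b c" if "E a b" "E b c" "c \<noteq> a" for a b c
  proof -
    have "deg E b \<ge> 2" using min_deg by blast
    then show ?thesis using zero[OF that(1), of c] that by (simp add: nb_prob_edge split: if_splits)
  qed
  then show ?thesis by (rule nb_invariant_constant[OF simple conn min_deg not_cycle, of f])
qed

text \<open>The sequences decrease, and the recursion passes to the limit because each mean is a
  finite sum. The limit is 0 at \<open>b = j\<close> and equals its mean elsewhere, so it is
  subharmonic and constant on edges; an edge into \<open>j\<close> shows that the constant is
  0.\<close>

lemma avoid_prob_tendsto_0:
  assumes ab: "E a b"
  shows "(\<lambda>n. avoid_prob E j n a b) \<longlonglongrightarrow> 0"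
proof -
  define L where "L a b = lim (\<lambda>n. avoid_prob E j n a b)" for a b
  have L: "(\<lambda>n. avoid_prob E j n a b) \<longlonglongrightarrow> L a b" for a b
    unfolding L_def using decseq_convergent[OF avoid_prob_decseq, of 0 E j a b] avoid_prob_nonneg[of E j _ a b]
    by (metis limI)
  have L_nonneg: "L a b \<ge> 0" for a b
    by (rule LIMSEQ_le_const[OF L]) (auto simp: avoid_prob_nonneg)
  have L_Suc: "L a b = (if b = j then 0 else nb_mean E L a b)" for a b
  proof -
    have "(\<lambda>n. avoid_prob E j (Suc n) a b) \<longlonglongrightarrow> (if b = j then 0 else nb_mean E L a b)"
      by (auto simp: nb_mean_def intro!: tendsto_intros L)
    then show ?thesis using LIMSEQ_Suc[OF L] LIMSEQ_unique by blast
  qed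
  have "L a b \<le> nb_mean E L a b" if "E a b" for a b
    using nb_mean_mono[of "\<lambda>_ _. 0" b L E a] L_nonneg L_Suc[of a b]
    by (cases "b = j") (simp_all add: nb_mean_const)
  then obtain k where k: "\<And>a b. E a b \<Longrightarrow> L a b = k"
    using nb_subharmonic_constant[of L] by metis
  have "nbrs E j \<noteq> {}" using min_deg[rule_format, of j] by (auto simp: deg_def)
  then obtain i where "E i j" using edge_sym by (auto simp: nbrs_def)
  then have "k = 0" using k[of i j] L_Suc[of i j] by simp
  then show ?thesis using L[of a b] k[OF ab] by simp
qed

text \<open>There are finitely many edges, so one \<open>N\<close> brings all avoidance
  probabilities down to 1/2, and every further delay by \<open>N\<close> halves them. A partial sum
  \<open>s\<close> then satisfies \<open>s \<le> N + s / 2\<close>, hence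
  \<open>s \<le> 2 * N\<close>.\<close>

lemma avoid_prob_summable:
  assumes ab: "E a b"
  shows "summable (\<lambda>n. avoid_prob E j n a b)"
proof -
  have "\<forall>\<^sub>F n in sequentially. \<forall>(a, b)\<in>directed_edges E. avoid_prob E j n a b < 1 / 2"
    by (rule eventually_ball_finite)
       (auto simp: directed_edges_def simp del: less_divide_eq_numeral1 intro!: order_tendstoD(2)[OF avoid_prob_tendsto_0])
  then obtain N where N: "\<And>a b. E a b \<Longrightarrow> avoid_prob E j N a b \<le> 1 / 2"
    unfolding eventually_sequentially directed_edges_def by (blast intro: less_imp_le)
  have shift: "avoid_prob E j (n + N) a b \<le> avoid_prob E j n a b / 2" if "E a b" for n a b
    using that
  proof (induction n arbitrary: a b)
    case 0
    then show ?case using N by simp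
  next
    case (Suc n)
    have "nb_mean E (avoid_prob E j (n + N)) a b \<le> nb_mean E (\<lambda>a b. avoid_prob E j n a b / 2) a b"
      unfolding nb_mean_def
    proof (rule sum_mono)
      fix c
      show "nb_prob E a b c * avoid_prob E j (n + N) b c \<le> nb_prob E a b c * (avoid_prob E j n b c / 2)"
      \<comment> \<open>The induction hypothesis speaks of edges only; off edges the weight is
        0.\<close>
      proof (cases "E b c")
        case True
        show ?thesis by (rule mult_left_mono[OF Suc.IH[OF True] nb_prob_nonneg])
      next
        case False
        then show ?thesis using nb_prob_edge[OF Suc.prems] by simp
      qed
    qed
    also have "\<dots> = nb_mean E (avoid_prob E j n) a b / 2"
      by (simp add: nb_mean_def sum_divide_distrib)
    finally show ?case by simp
  qed
  show ?thesis
  proof (rule bounded_imp_summable)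
    fix n
    let ?s = "\<lambda>m. \<Sum>k<m. avoid_prob E j k a b"
    have split: "?s (m + N) = ?s N + (\<Sum>k<m. avoid_prob E j (k + N) a b)" for m
      by (induction m) simp_all
    have "?s (Suc n) \<le> ?s (Suc n + N)"
      by (rule sum_mono2) (auto simp: avoid_prob_nonneg)
    also have "\<dots> = ?s N + (\<Sum>k<Suc n. avoid_prob E j (k + N) a b)"
      by (rule split)
    also have "\<dots> \<le> real N + ?s (Suc n) / 2"
    proof (rule add_mono)
      show "?s N \<le> real N"
        using sum_bounded_above[of "{..<N}" "\<lambda>k. avoid_prob E j k a b" 1] by (simp add: avoid_prob_le_1)
      show "(\<Sum>k<Suc n. avoid_prob E j (k + N) a b) \<le> ?s (Suc n) / 2"
        unfolding sum_divide_distrib by (rule sum_mono) (rule shift[OF ab])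
    qed
    finally show "(\<Sum>k\<le>n. avoid_prob E j k a b) \<le> 2 * real N"
      by (simp add: lessThan_Suc_atMost)
  qed (auto simp: avoid_prob_nonneg)
qed

lemma mean_return_nonneg: "E a b \<Longrightarrow> mean_return E j a b \<ge> 0"
  unfolding mean_return_def by (intro suminf_nonneg avoid_prob_summable avoid_prob_nonneg)

text \<open>First-step analysis by splitting off the term \<open>n = 0\<close> of the series. Inside
  \<open>nb_mean\<close> the test \<open>a = j\<close> is evaluated at \<open>b\<close>: on reaching
  \<open>j\<close> nothing more is counted.\<close>

lemma mean_return_step:
  assumes ab: "E a b"
  shows "mean_return E j a b = 1 + nb_mean E (\<lambda>a b. if a = j then 0 else mean_return E j a b) a b"
proof -
  have sums: "(\<lambda>n. nb_prob E a b c * avoid_prob E j n b c) sums (nb_prob E a b c * mean_return E j b c)" for c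
    using sums_mult[OF avoid_prob_summable[of b c j, THEN summable_sums]] nb_prob_edge[OF ab]
    by (cases "E b c") (auto simp only: mean_return_def sums_zero mult_zero_left simp_thms if_False)
  have "(\<lambda>n. \<Sum>c\<in>UNIV. nb_prob E a b c * avoid_prob E j n b c) sums
      (\<Sum>c\<in>UNIV. nb_prob E a b c * mean_return E j b c)"
    by (rule sums_sum) (rule sums)
  then have tail: "(\<Sum>n. avoid_prob E j (Suc n) a b) = (if b = j then 0 else nb_mean E (mean_return E j) a b)"
    using sums_unique by (force simp: nb_mean_def)
  have "mean_return E j a b = 1 + (\<Sum>n. avoid_prob E j (Suc n) a b)"
    unfolding mean_return_def using suminf_split_head[OF avoid_prob_summable[OF ab, of j]] by simp
  also have "\<dots> = 1 + (if b = j then 0 else nb_mean E (mean_return E j) a b)"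
    by (simp only: tail)
  also have "\<dots> = 1 + nb_mean E (\<lambda>a b. if a = j then 0 else mean_return E j a b) a b"
    by (simp add: nb_mean_def)
  finally show ?thesis .
qed

end

section \<open>Path probabilities of the non-backtracking random walk\<close>

lemma space_nbrw [simp]: "space (nbrw E x) = UNIV"
  using sets_eq_imp_space_eq[OF sets_nbrw[of E x]] by (simp add: space_PiM)

lemma measurable_nbrw_coordinate [measurable]:
  "(\<lambda>\<omega>. \<omega> k) \<in> measurable (nbrw E x) (count_space UNIV)"
  by (subst measurable_cong_sets[OF sets_nbrw refl]) (rule measurable_component_singleton, simp)

text \<open>The chain rule for the trajectory measure: \<open>Q\<close> depends on the positions
  before time \<open>n\<close> only, and throughout \<open>Q\<close> the kernel gives
  \<open>c\<close> the same mass \<open>q\<close>. It reduces path probabilities to products without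
  further use of the Ionescu-Tulcea construction.\<close>

lemma emeasure_nbrw_step:
  fixes E :: "'v::finite \<Rightarrow> 'v \<Rightarrow> bool"
  assumes past: "\<And>\<omega>. Q (restrict \<omega> {0..<n}) \<longleftrightarrow> Q \<omega>"
    and const: "\<And>\<omega>. Q \<omega> \<Longrightarrow> pmf (nbrw_step E x n \<omega>) c = q"
  shows "emeasure (nbrw E x) {\<omega>. Q \<omega> \<and> \<omega> n = c} = ennreal q * emeasure (nbrw E x) {\<omega>. Q \<omega>}"
proof -
  let ?M = "\<lambda>_::nat. count_space (UNIV :: 'v set)"
  let ?S = "\<lambda>k. PiE {0..<k} (\<lambda>_. UNIV :: 'v set)"
  interpret IT: Ionescu_Tulcea "\<lambda>k \<omega>. measure_pmf (nbrw_step E x k \<omega>)" ?M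
    by (rule Ionescu_Tulcea_nbrw)
  have PiM: "PiM {0..<k} ?M = count_space (?S k)" for k
    by (rule count_space_PiM_finite) (auto intro: countable_finite)
  \<comment> \<open>\<open>IT.C 0 k\<close> is the law of the first \<open>k\<close> positions, so
    it measures cylinder events.\<close>
  have cyl: "emeasure (nbrw E x) {\<omega>. restrict \<omega> {0..<k} \<in> A} = emeasure (IT.C 0 k (\<lambda>_. undefined)) A"
    if "A \<subseteq> ?S k" for A k
  proof -
    have A: "A \<in> sets (PiM {0..<k} ?M)" using that by (simp add: PiM)
    have "{\<omega>. restrict \<omega> {0..<k} \<in> A} = prod_emb UNIV ?M {0..<k} A"
      by (auto simp: prod_emb_def space_PiM)
    then have "emeasure (nbrw E x) {\<omega>. restrict \<omega> {0..<k} \<in> A} = emeasure (IT.CI {0..<k}) A"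
      using IT.lim[OF _ A] by (simp add: nbrw_def)
    also have "\<dots> = emeasure (IT.C 0 k (\<lambda>_. undefined)) (prod_emb {0..<k} ?M {0..<k} A)"
      by (rule IT.emeasure_CI[OF _ A]) simp
    also have "prod_emb {0..<k} ?M {0..<k} A = A"
      using that by (intro prod_emb_id) (simp add: PiE_def)
    finally show ?thesis .
  qed
  let ?B = "{\<omega> \<in> ?S n. Q \<omega>}" and ?A = "{\<omega> \<in> ?S (Suc n). Q \<omega> \<and> \<omega> n = c}"
  have upd: "Q (fun_upd \<omega> n y) \<longleftrightarrow> Q \<omega>" for \<omega> y
    using past[of \<omega>] past[of "fun_upd \<omega> n y"] by (simp cong: restrict_cong)
  have past': "Q (restrict \<omega> {0..<Suc n}) \<longleftrightarrow> Q \<omega>" for \<omega>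
    using past[of \<omega>] past[of "restrict \<omega> {0..<Suc n}"] by (simp add: Int_absorb1)
  have spC: "space (IT.C 0 n (\<lambda>_. undefined)) = ?S n"
    by (simp add: IT.space_C space_PiM)
  have eP: "IT.eP n \<in> measurable (IT.C 0 n (\<lambda>_. undefined)) (subprob_algebra (PiM {0..<Suc n} ?M))"
  proof -
    have "sets (IT.C 0 n (\<lambda>_. undefined)) = sets (PiM {0..<n} ?M)" by (simp add: IT.sets_C)
    from measurable_cong_sets[OF this refl] IT.measurable_eP[of n] show ?thesis by blast
  qed
  have "{\<omega>. Q \<omega> \<and> \<omega> n = c} = {\<omega>. restrict \<omega> {0..<Suc n} \<in> ?A}"
    by (auto simp: past' simp del: restrict_apply) auto
  then have "emeasure (nbrw E x) {\<omega>. Q \<omega> \<and> \<omega> n = c} = emeasure (IT.C 0 (Suc n) (\<lambda>_. undefined)) ?A"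
    using cyl[of ?A "Suc n"] by auto
  \<comment> \<open>\<open>IT.C 0 (Suc n)\<close> is \<open>IT.C 0 n\<close> followed by the kernel
    that appends position \<open>n\<close>.\<close>
  also have "\<dots> = (\<integral>\<^sup>+ \<omega>. emeasure (IT.eP n \<omega>) ?A \<partial>IT.C 0 n (\<lambda>_. undefined))"
    using emeasure_bind[OF _ eP, of ?A] by (simp add: spC PiM PiE_eq_empty_iff Collect_mono_iff)
  also have "\<dots> = (\<integral>\<^sup>+ \<omega>. ennreal q * indicator ?B \<omega> \<partial>IT.C 0 n (\<lambda>_. undefined))"
  proof (rule nn_integral_cong)
    fix \<omega> assume "\<omega> \<in> space (IT.C 0 n (\<lambda>_. undefined))"
    then have w: "\<omega> \<in> ?S n" by (simp add: spC)
    have "emeasure (IT.eP n \<omega>) ?A = emeasure (nbrw_step E x n \<omega>) ((\<lambda>y. fun_upd \<omega> n y) -` ?A \<inter> space (?M n))"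
      using w by (intro IT.emeasure_eP) (auto simp: space_PiM PiM)
    also have "(\<lambda>y. fun_upd \<omega> n y) -` ?A \<inter> space (?M n) = (if Q \<omega> then {c} else {})"
      using w by (auto simp: upd PiE_iff extensional_def)
    also have "emeasure (nbrw_step E x n \<omega>) \<dots> = ennreal q * indicator ?B \<omega>"
      using w const[of \<omega>] by (auto simp: emeasure_pmf_single)
    finally show "emeasure (IT.eP n \<omega>) ?A = ennreal q * indicator ?B \<omega>" .
  qed
  also have "\<dots> = ennreal q * emeasure (IT.C 0 n (\<lambda>_. undefined)) ?B"
    by (rule nn_integral_cmult_indicator) (auto simp: IT.sets_C PiM)
  also have "emeasure (IT.C 0 n (\<lambda>_. undefined)) ?B = emeasure (nbrw E x) {\<omega>. restrict \<omega> {0..<n} \<in> ?B}"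
    using cyl[of ?B n] by auto
  also have "{\<omega>. restrict \<omega> {0..<n} \<in> ?B} = {\<omega>. Q \<omega>}"
    by (auto simp: past simp del: restrict_apply)
  finally show ?thesis .
qed

corollary measure_nbrw_step:
  fixes E :: "'v::finite \<Rightarrow> 'v \<Rightarrow> bool"
  assumes "\<And>\<omega>. Q (restrict \<omega> {0..<n}) \<longleftrightarrow> Q \<omega>"
    and "\<And>\<omega>. Q \<omega> \<Longrightarrow> pmf (nbrw_step E x n \<omega>) c = q" and "q \<ge> 0"
  shows "measure (nbrw E x) {\<omega>. Q \<omega> \<and> \<omega> n = c} = q * measure (nbrw E x) {\<omega>. Q \<omega>}"
  using emeasure_nbrw_step[of Q n E x c q, OF assms(1,2)] assms(3)
  by (simp add: measure_def enn2real_mult)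

lemma sets_nbrw_Collect: "Measurable.pred (nbrw E x) Q \<Longrightarrow> {\<omega>. Q \<omega>} \<in> sets (nbrw E x)"
  by (drule predE) simp

lemma measure_nbrw_partition:
  fixes E :: "'v::finite \<Rightarrow> 'v \<Rightarrow> bool"
  assumes [measurable]: "Measurable.pred (nbrw E x) Q"
  shows "measure (nbrw E x) {\<omega>. Q \<omega>} = (\<Sum>a\<in>UNIV. measure (nbrw E x) {\<omega>. Q \<omega> \<and> \<omega> k = a})"
proof -
  interpret prob_space "nbrw E x" by (rule prob_space_nbrw)
  have "measure (nbrw E x) (\<Union>a\<in>UNIV. {\<omega>. Q \<omega> \<and> \<omega> k = a}) = (\<Sum>a\<in>UNIV. measure (nbrw E x) {\<omega>. Q \<omega> \<and> \<omega> k = a})"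
    by (rule finite_measure_finite_Union)
       (auto simp: disjoint_family_on_def intro!: sets_nbrw_Collect)
  moreover have "(\<Union>a\<in>UNIV. {\<omega>. Q \<omega> \<and> \<omega> k = a}) = {\<omega>. Q \<omega>}" by auto
  ultimately show ?thesis by simp
qed

lemma measure_nbrw_start: "measure (nbrw E x) {\<omega>. \<omega> 0 = a} = (if a = x then 1 else 0)"
proof -
  interpret prob_space "nbrw E x" by (rule prob_space_nbrw)
  show ?thesis
    using measure_nbrw_step[of "\<lambda>_. True" 0 E x a "pmf (return_pmf x) a"] prob_space
    by (auto split: if_splits)
qed

lemma measure_nbrw_first_edge:
  "measure (nbrw E x) {\<omega>. \<omega> 0 = a \<and> \<omega> 1 = b} = (if a = x then pmf (pmf_of_set (nbrs E x)) b else 0)"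
  using measure_nbrw_step[of "\<lambda>\<omega>. \<omega> 0 = a" 1 E x b "pmf (pmf_of_set (nbrs E a)) b"]
  by (auto simp: measure_nbrw_start split: if_splits)

text \<open>
  Let \<open>u\<^sub>m(a, b)\<close> be the probability of stepping first to \<open>y\<close>, avoiding \<open>j\<close> at the times
  \<open>1, \<dots>, m\<close>, and crossing \<open>(a, b)\<close> at time \<open>m\<close>. The pairing of \<open>u\<^sub>m\<close> with \<open>avoid_prob E j (n - m)\<close>
  does not depend on \<open>m\<close>; the cases \<open>m = 0\<close> and \<open>m = n\<close> are the two sides below.
\<close>

lemma measure_nbrw_avoid:
  fixes E :: "'v::finite \<Rightarrow> 'v \<Rightarrow> bool"
  shows "measure (nbrw E x) {\<omega>. \<omega> 1 = y \<and> (\<forall>k\<in>{1..n}. \<omega> k \<noteq> j)}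
    = pmf (pmf_of_set (nbrs E x)) y * avoid_prob E j n x y"
proof -
  define Q where "Q m a b \<omega> \<longleftrightarrow> \<omega> 1 = y \<and> (\<forall>k\<in>{1..m}. \<omega> k \<noteq> j) \<and> \<omega> m = a \<and> \<omega> (Suc m) = b"
    for m a b and \<omega> :: "nat \<Rightarrow> 'v"
  define u where "u m a b = measure (nbrw E x) {\<omega>. Q m a b \<omega>}" for m a b
  have [measurable]: "Measurable.pred (nbrw E x) (Q m a b)" for m a b
    unfolding Q_def by measurable
  have u_Suc: "u (Suc m) b c = (\<Sum>a\<in>UNIV. if b = j then 0 else nb_prob E a b c * u m a b)" for m b c
  proof -
    have "u (Suc m) b c = (\<Sum>a\<in>UNIV. measure (nbrw E x) {\<omega>. Q (Suc m) b c \<omega> \<and> \<omega> m = a})"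
      unfolding u_def by (rule measure_nbrw_partition) measurable
    also have "\<dots> = (\<Sum>a\<in>UNIV. if b = j then 0 else nb_prob E a b c * u m a b)"
    proof (rule sum.cong[OF refl])
      fix a
      show "measure (nbrw E x) {\<omega>. Q (Suc m) b c \<omega> \<and> \<omega> m = a} = (if b = j then 0 else nb_prob E a b c * u m a b)"
      proof (cases "b = j")
        case True
        then have "{\<omega>. Q (Suc m) b c \<omega> \<and> \<omega> m = a} = {}" by (auto simp: Q_def)
        then show ?thesis using True by (simp only:) simp
      next
        case False
        then have "{\<omega>. Q (Suc m) b c \<omega> \<and> \<omega> m = a} = {\<omega>. Q m a b \<omega> \<and> \<omega> (Suc (Suc m)) = c}"
          by (auto simp: Q_def le_Suc_eq)
        also have "measure (nbrw E x) \<dots> = nb_prob E a b c * measure (nbrw E x) {\<omega>. Q m a b \<omega>}"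
          by (rule measure_nbrw_step) (auto simp: Q_def nb_prob_def)
        finally show ?thesis using False by (simp add: u_def)
      qed
    qed
    finally show ?thesis .
  qed
  \<comment> \<open>\<open>u\<close> is pushed forward and \<open>avoid_prob\<close> pulled back by
    the same kernel, cut off at \<open>b = j\<close>; exchanging the sums moves it from one factor
    to the other.\<close>
  have pairing_step: "(\<Sum>a\<in>UNIV. \<Sum>b\<in>UNIV. u m a b * avoid_prob E j (Suc n) a b)
      = (\<Sum>b\<in>UNIV. \<Sum>c\<in>UNIV. u (Suc m) b c * avoid_prob E j n b c)" for m n
  proof -
    have "(\<Sum>b\<in>UNIV. \<Sum>c\<in>UNIV. u (Suc m) b c * avoid_prob E j n b c)
        = (\<Sum>b\<in>UNIV. \<Sum>c\<in>UNIV. \<Sum>a\<in>UNIV. if b = j then 0 else u m a b * (nb_prob E a b c * avoid_prob E j n b c))"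
      unfolding u_Suc sum_distrib_right by (intro sum.cong refl) simp
    also have "\<dots> = (\<Sum>b\<in>UNIV. \<Sum>a\<in>UNIV. \<Sum>c\<in>UNIV. if b = j then 0 else u m a b * (nb_prob E a b c * avoid_prob E j n b c))"
      by (intro sum.cong refl sum.swap)
    also have "\<dots> = (\<Sum>b\<in>UNIV. \<Sum>a\<in>UNIV. u m a b * avoid_prob E j (Suc n) a b)"
      by (intro sum.cong refl) (simp add: nb_mean_def sum_distrib_left)
    also have "\<dots> = (\<Sum>a\<in>UNIV. \<Sum>b\<in>UNIV. u m a b * avoid_prob E j (Suc n) a b)"
      by (rule sum.swap)
    finally show ?thesis by simp
  qed
  have pairing: "(\<Sum>a\<in>UNIV. \<Sum>b\<in>UNIV. u 0 a b * avoid_prob E j n a b)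
      = (\<Sum>a\<in>UNIV. \<Sum>b\<in>UNIV. u m a b * avoid_prob E j (n - m) a b)" if "m \<le> n" for m
    using that
  proof (induction m)
    case (Suc m)
    then show ?case using pairing_step[of m "n - Suc m"] by (simp add: Suc_diff_Suc)
  qed simp
  have "measure (nbrw E x) {\<omega>. \<omega> 1 = y \<and> (\<forall>k\<in>{1..n}. \<omega> k \<noteq> j)}
      = (\<Sum>a\<in>UNIV. \<Sum>b\<in>UNIV. u n a b)"
    by (subst measure_nbrw_partition[where k=n], measurable,
        subst measure_nbrw_partition[where k="Suc n"], measurable)
       (simp add: u_def Q_def conj_assoc)
  \<comment> \<open>At \<open>m = n\<close> the second factor is \<open>avoid_prob E j 0\<close>,
    which is 1.\<close>
  also have "\<dots> = (\<Sum>a\<in>UNIV. \<Sum>b\<in>UNIV. u 0 a b * avoid_prob E j n a b)"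
    using pairing[of n] by simp
  also have "\<dots> = (\<Sum>a\<in>UNIV. \<Sum>b\<in>UNIV. if b = y then (if a = x then pmf (pmf_of_set (nbrs E x)) y * avoid_prob E j n x y else 0) else 0)"
  proof (intro sum.cong refl)
    fix a b
    \<comment> \<open>Only \<open>(x, y)\<close> carries mass: the law fixes the start, and for
      \<open>m = 0\<close> the times \<open>Suc m\<close> and 1 coincide.\<close>
    have "u 0 a b = (if b = y then (if a = x then pmf (pmf_of_set (nbrs E x)) y else 0) else 0)"
    proof (cases "b = y")
      case True
      then have "{\<omega>. Q 0 a b \<omega>} = {\<omega>. \<omega> 0 = a \<and> \<omega> 1 = b}" by (auto simp: Q_def)
      then show ?thesis using True by (simp only: u_def measure_nbrw_first_edge) simp
    next
      case False
      then have "{\<omega>. Q 0 a b \<omega>} = {}" by (auto simp: Q_def)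
      then show ?thesis using False by (simp only: u_def) simp
    qed
    then show "u 0 a b * avoid_prob E j n a b
        = (if b = y then (if a = x then pmf (pmf_of_set (nbrs E x)) y * avoid_prob E j n x y else 0) else 0)"
      by simp
  qed
  also have "\<dots> = pmf (pmf_of_set (nbrs E x)) y * avoid_prob E j n x y"
    by simp
  finally show ?thesis .
qed

section \<open>Tail events and measurability of hitting and return times\<close>

lemma less_Inf_enat_iff: "enat n < Inf {enat k | k. P k} \<longleftrightarrow> (\<forall>k\<le>n. \<not> P k)"
proof
  assume less: "enat n < Inf {enat k | k. P k}"
  show "\<forall>k\<le>n. \<not> P k"
  proof (intro allI impI notI)
    fix k assume "k \<le> n" "P k"
    then have "Inf {enat k | k. P k} \<le> enat n"
      by (intro Inf_lower2[of "enat k"]) auto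
    with less show False by simp
  qed
next
  assume none: "\<forall>k\<le>n. \<not> P k"
  have "enat (Suc n) \<le> Inf {enat k | k. P k}"
  proof (rule Inf_greatest)
    fix e assume "e \<in> {enat k | k. P k}"
    then obtain k where k: "e = enat k" "P k" by blast
    then have "\<not> k \<le> n" using none by blast
    then show "enat (Suc n) \<le> e" using k by simp
  qed
  then show "enat n < Inf {enat k | k. P k}"
    by (rule less_le_trans[rotated]) simp
qed

lemma less_return_time_iff: "enat n < return_time v \<omega> \<longleftrightarrow> (\<forall>k\<in>{1..n}. \<omega> k \<noteq> v)"
  by (auto simp: return_time_def less_Inf_enat_iff)

lemma less_hitting_time_iff: "enat n < hitting_time v \<omega> \<longleftrightarrow> (\<forall>k\<le>n. \<omega> k \<noteq> v)"
  by (simp add: hitting_time_def less_Inf_enat_iff)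

lemma enat_eqI_less: "(\<And>n. enat n < a \<longleftrightarrow> enat n < b) \<Longrightarrow> a = b"
  by (metis enat_ord_simps(4) enat.exhaust linorder_neq_iff less_irrefl enat_iless)

lemma hitting_time_eq_return_time:
  "hitting_time v \<omega> = (if \<omega> 0 = v then 0 else return_time v \<omega>)"
proof (cases "\<omega> 0 = v")
  case True
  then have "\<not> enat 0 < hitting_time v \<omega>" unfolding less_hitting_time_iff by auto
  then show ?thesis using True by (simp add: enat_0)
next
  case False
  have "(\<forall>k\<le>n. \<omega> k \<noteq> v) \<longleftrightarrow> (\<forall>k\<in>{1..n}. \<omega> k \<noteq> v)" for n
    using False by (metis One_nat_def Suc_leI atLeastAtMost_iff gr0I)
  then have "hitting_time v \<omega> = return_time v \<omega>"
    by (intro enat_eqI_less) (simp only: less_hitting_time_iff less_return_time_iff)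
  then show ?thesis using False by simp
qed

text \<open>An extended natural number is determined by the finite numbers below it, so each level
  set is a countable combination of events about finitely many positions.\<close>

lemma measurable_return_time [measurable]:
  fixes E :: "'v::finite \<Rightarrow> 'v \<Rightarrow> bool"
  shows "return_time v \<in> measurable (nbrw E x) (count_space UNIV)"
proof (rule measurable_count_space_eq_countable[THEN iffD2, OF _ conjI])
  show "countable (UNIV :: enat set)" by simp
  show "\<forall>a\<in>UNIV. return_time v -` {a} \<inter> space (nbrw E x) \<in> sets (nbrw E x)"
  proof
    fix a
    have "return_time v -` {a} \<inter> space (nbrw E x)
        = {\<omega>. \<forall>n. (\<forall>k\<in>{1..n}. \<omega> k \<noteq> v) \<longleftrightarrow> enat n < a}"
      unfolding less_return_time_iff[symmetric] using enat_eqI_less[of _ a] by auto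
    also have "\<dots> \<in> sets (nbrw E x)" by (intro sets_nbrw_Collect) measurable
    finally show "return_time v -` {a} \<inter> space (nbrw E x) \<in> sets (nbrw E x)" .
  qed
qed auto

section \<open>Expected times as sums of avoidance probabilities\<close>

context nb_graph begin

lemma pmf_nbrs: "pmf (pmf_of_set (nbrs E x)) y = (if E x y then 1 / real (deg E x) else 0)"
proof -
  have "nbrs E x \<noteq> {}" using min_deg[rule_format, of x] by (auto simp: deg_def)
  then show ?thesis by (auto simp: deg_def nbrs_def)
qed

lemma deg_pos: "real (deg E x) > 0"
  using min_deg[rule_format, of x] by linarith

text \<open>Conditioning on the first step cancels its probability \<open>1 / deg E x\<close>, so
  the conditional tails are the avoidance probabilities.\<close>

lemma nn_integral_return_time_via:
  assumes xy: "E x y"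
  shows "(\<integral>\<^sup>+ \<omega>. ennreal_of_enat (return_time j \<omega>) \<partial>uniform_measure (nbrw E x) {\<omega> \<in> space (nbrw E x). \<omega> 1 = y})
    = ennreal (mean_return E j x y)"
proof -
  interpret prob_space "nbrw E x" by (rule prob_space_nbrw)
  let ?A = "{\<omega>. \<omega> 1 = y}"
  have A: "?A \<in> sets (nbrw E x)" by (intro sets_nbrw_Collect) measurable
  have prob_A: "measure (nbrw E x) ?A = 1 / real (deg E x)"
    \<comment> \<open>For \<open>n = 0\<close> the avoidance condition is empty.\<close>
    using measure_nbrw_avoid[of E x y 0 j] xy by (simp add: pmf_nbrs)
  have "emeasure (uniform_measure (nbrw E x) ?A) {\<omega>. enat n < return_time j \<omega>} = ennreal (avoid_prob E j n x y)" for n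
  proof -
    have "emeasure (uniform_measure (nbrw E x) ?A) {\<omega>. enat n < return_time j \<omega>}
        = emeasure (nbrw E x) (?A \<inter> {\<omega>. enat n < return_time j \<omega>}) / emeasure (nbrw E x) ?A"
      by (rule emeasure_uniform_measure[OF A]) (intro sets_nbrw_Collect, measurable)
    also have "?A \<inter> {\<omega>. enat n < return_time j \<omega>} = {\<omega>. \<omega> 1 = y \<and> (\<forall>k\<in>{1..n}. \<omega> k \<noteq> j)}"
      by (auto simp: less_return_time_iff)
    also have "emeasure (nbrw E x) \<dots> / emeasure (nbrw E x) ?A = ennreal (avoid_prob E j n x y / real (deg E x)) / ennreal (1 / real (deg E x))"
      unfolding emeasure_eq_measure prob_A measure_nbrw_avoid using xy by (simp add: pmf_nbrs)
    also have "\<dots> = ennreal (avoid_prob E j n x y)"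
      using deg_pos[of x] by (subst divide_ennreal) (auto simp: avoid_prob_nonneg)
    finally show ?thesis .
  qed
  then have "(\<integral>\<^sup>+ \<omega>. ennreal_of_enat (return_time j \<omega>) \<partial>uniform_measure (nbrw E x) ?A)
      = (\<Sum>n. ennreal (avoid_prob E j n x y))"
    by (subst nn_integral_enat_function) simp_all
  also have "\<dots> = ennreal (mean_return E j x y)"
    unfolding mean_return_def by (intro suminf_ennreal2 avoid_prob_nonneg avoid_prob_summable xy)
  finally show ?thesis by simp
qed

text \<open>Tails are split by the first step. The start \<open>x\<close> is arbitrary:
  \<open>x = j\<close> gives return times, \<open>x \<noteq> j\<close> hitting times.\<close>

lemma nn_integral_return_time:
  "(\<integral>\<^sup>+ \<omega>. ennreal_of_enat (return_time j \<omega>) \<partial>nbrw E x)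
    = ennreal ((\<Sum>y\<in>nbrs E x. mean_return E j x y) / real (deg E x))"
proof -
  interpret prob_space "nbrw E x" by (rule prob_space_nbrw)
  let ?s = "\<lambda>n. (\<Sum>y\<in>nbrs E x. avoid_prob E j n x y) / real (deg E x)"
  have sums: "?s sums ((\<Sum>y\<in>nbrs E x. mean_return E j x y) / real (deg E x))"
    unfolding mean_return_def
    by (intro sums_divide sums_sum summable_sums avoid_prob_summable) (simp add: nbrs_def)
  have "measure (nbrw E x) {\<omega>. enat n < return_time j \<omega>} = ?s n" for n
  proof -
    have "measure (nbrw E x) {\<omega>. enat n < return_time j \<omega>}
        = (\<Sum>y\<in>UNIV. measure (nbrw E x) {\<omega>. enat n < return_time j \<omega> \<and> \<omega> 1 = y})"
      by (rule measure_nbrw_partition) measurable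
    also have "\<dots> = (\<Sum>y\<in>UNIV. pmf (pmf_of_set (nbrs E x)) y * avoid_prob E j n x y)"
      unfolding measure_nbrw_avoid[symmetric] less_return_time_iff by (simp add: conj_commute)
    also have "\<dots> = (\<Sum>y\<in>nbrs E x. avoid_prob E j n x y / real (deg E x))"
      by (rule sum.mono_neutral_cong_right) (simp_all add: pmf_nbrs, simp_all add: nbrs_def)
    finally show ?thesis by (simp add: sum_divide_distrib)
  qed
  then have "(\<integral>\<^sup>+ \<omega>. ennreal_of_enat (return_time j \<omega>) \<partial>nbrw E x) = (\<Sum>n. ennreal (?s n))"
    by (subst nn_integral_enat_function) (simp_all add: emeasure_eq_measure)
  also have "\<dots> = ennreal (\<Sum>n. ?s n)"
    using sums by (intro suminf_ennreal2 divide_nonneg_nonneg sum_nonneg avoid_prob_nonneg)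
      (auto simp: sums_iff)
  finally show ?thesis using sums by (simp add: sums_iff)
qed

lemma expected_return_time_via_eq:
  "E x y \<Longrightarrow> expected_return_time_via E x y = ennreal (mean_return E x x y)"
  unfolding expected_return_time_via_def by (rule nn_integral_return_time_via)

lemma expected_return_time_eq:
  "expected_return_time E x = ennreal ((\<Sum>y\<in>nbrs E x. mean_return E x x y) / real (deg E x))"
  unfolding expected_return_time_def by (rule nn_integral_return_time)

lemma expected_hitting_time_eq:
  "expected_hitting_time E x j
    = ennreal ((\<Sum>y\<in>nbrs E x. if x = j then 0 else mean_return E j x y) / real (deg E x))"
proof -
  interpret prob_space "nbrw E x" by (rule prob_space_nbrw)
  \<comment> \<open>The trajectory space contains paths from every start; position 0 is
    \<open>x\<close> only almost surely.\<close>
  have "AE \<omega> in nbrw E x. \<omega> 0 = x"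
    using measure_nbrw_start[of E x x] by (subst prob_Collect_eq_1[symmetric]) (simp_all add: sets_nbrw_Collect)
  then have "expected_hitting_time E x j
      = (\<integral>\<^sup>+ \<omega>. (if x = j then 0 else ennreal_of_enat (return_time j \<omega>)) \<partial>nbrw E x)"
    unfolding expected_hitting_time_def
    by (intro nn_integral_cong_AE) (auto simp: hitting_time_eq_return_time elim!: eventually_mono)
  then show ?thesis by (cases "x = j") (simp_all add: nn_integral_return_time)
qed

end

section \<open>The fundamental matrix on directed edges\<close>

lemma matrix_inv_inverse:
  fixes A :: "real^'n^'n"
  assumes "invertible A"
  shows "A ** matrix_inv A = mat 1" "matrix_inv A ** A = mat 1"
  using someI_ex[OF assms[unfolded invertible_def]] by (auto simp: matrix_inv_def)

lemma matrix_inv_eqI: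
  fixes A B :: "real^'n^'n"
  assumes BA: "B ** A = mat 1"
  shows "matrix_inv A = B"
proof -
  have inv: "invertible A" using BA by (auto simp: invertible_left_inverse)
  have "matrix_inv A = (B ** A) ** matrix_inv A" by (simp add: BA)
  also have "\<dots> = B ** (A ** matrix_inv A)" by (rule matrix_mul_assoc[symmetric])
  also have "\<dots> = B" by (simp add: matrix_inv_inverse(1)[OF inv])
  finally show ?thesis .
qed

context nb_graph begin

text \<open>Each undirected edge has exactly two orientations, distinct because there are no
  loops.\<close>

lemma card_directed_edges: "card (directed_edges E) = 2 * num_edges E"
proof -
  let ?D = "directed_edges E" and ?und = "\<lambda>(a, b). {a, b}"
  have fibre: "card {p \<in> ?D. ?und p = s} = 2" if s: "s \<in> ?und ` ?D" for s
  proof -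
    obtain p where p: "p \<in> ?D" "s = ?und p" using s by blast
    obtain a b where "p = (a, b)" by (cases p)
    with p have ab: "E a b" "s = {a, b}" by (auto simp: directed_edges_def)
    then have "a \<noteq> b" using simple by (auto simp: simple_graph_def irreflp_def)
    moreover have "{p \<in> ?D. ?und p = s} = {(a, b), (b, a)}"
      using ab edge_sym by (auto simp: directed_edges_def doubleton_eq_iff)
    ultimately show ?thesis by simp
  qed
  have "card ?D = (\<Sum>s\<in>?und ` ?D. card {p \<in> ?D. ?und p = s})"
    using sum.image_gen[of ?D "\<lambda>_. 1::nat" ?und] by simp
  also have "\<dots> = 2 * card (?und ` ?D)" using fibre by simp
  also have "?und ` ?D = {{i, j} | i j. E i j}" by (auto simp: directed_edges_def image_iff)
  finally show ?thesis by (simp add: num_edges_def)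
qed

lemma directed_edges_nonempty: "directed_edges E \<noteq> {}"
proof -
  have "nbrs E x \<noteq> {}" for x using min_deg[rule_format, of x] by (auto simp: deg_def)
  then show ?thesis by (auto simp: directed_edges_def nbrs_def)
qed

lemma num_edges_pos: "real (num_edges E) > 0"
  using card_directed_edges directed_edges_nonempty by (metis card_gt_0_iff finite mult_0_right of_nat_0_less_iff gr0I)


end

section \<open>Matrices acting on functions of directed edges\<close>

locale nb_edge_matrices = nb_graph E for E :: "'v::finite \<Rightarrow> 'v \<Rightarrow> bool" +
  fixes dedge :: "'e::finite \<Rightarrow> 'v \<times> 'v"
  assumes bij: "bij_betw dedge UNIV (directed_edges E)"
begin

definition edge_vec :: "('v \<Rightarrow> 'v \<Rightarrow> real) \<Rightarrow> real^'e" where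
  "edge_vec f = (\<chi> e. f (fst (dedge e)) (snd (dedge e)))"

lemma edge_dedge: "E (fst (dedge e)) (snd (dedge e))"
  using bij_betwE[OF bij] by (auto simp: directed_edges_def case_prod_unfold)

lemma sum_edge_vec: "(\<Sum>e\<in>UNIV. f (fst (dedge e)) (snd (dedge e))) = (\<Sum>(a, b)\<in>directed_edges E. f a b)"
  using sum.reindex_bij_betw[OF bij, of "\<lambda>(a, b). f a b"] by (simp add: case_prod_unfold)

lemma edge_vec_cases: obtains f where "v = edge_vec f"
proof -
  have "inv dedge (dedge e) = e" for e
    using bij by (simp add: bij_betw_def)
  then have "v = edge_vec (\<lambda>a b. v $ inv dedge (a, b))" by (simp add: edge_vec_def vec_eq_iff)
  then show ?thesis by (rule that)
qed

lemma edge_vec_cong: "(\<And>a b. E a b \<Longrightarrow> f a b = g a b) \<Longrightarrow> edge_vec f = edge_vec g"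
  using edge_dedge by (simp add: edge_vec_def)

lemma P_nb_edge_vec: "P_nb E dedge *v edge_vec f = edge_vec (nb_mean E f)"
proof -
  have "(\<Sum>f'\<in>UNIV. P_nb E dedge $ e $ f' * edge_vec f $ f') = nb_mean E f (fst (dedge e)) (snd (dedge e))" for e
  proof -
    obtain a b where e: "dedge e = (a, b)" by (cases "dedge e")
    with edge_dedge[of e] have ab: "E a b" by simp
    let ?p = "\<lambda>k l. if b = k \<and> l \<noteq> a then 1 / (real (deg E b) - 1) else 0"
    have "(\<Sum>f'\<in>UNIV. P_nb E dedge $ e $ f' * edge_vec f $ f')
        = (\<Sum>f'\<in>UNIV. (\<lambda>k l. ?p k l * f k l) (fst (dedge f')) (snd (dedge f')))"
      by (intro sum.cong refl) (simp add: P_nb_def edge_vec_def e case_prod_unfold)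
    also have "\<dots> = (\<Sum>k\<in>UNIV. \<Sum>l\<in>nbrs E k. ?p k l * f k l)"
      by (rule trans[OF sum_edge_vec[of "\<lambda>k l. ?p k l * f k l"] sum_edges_out])
    \<comment> \<open>Only edges with tail \<open>b\<close> can follow
      \<open>(a, b)\<close>.\<close>
    also have "\<dots> = (\<Sum>k\<in>UNIV. if k = b then (\<Sum>l\<in>nbrs E b. ?p b l * f b l) else 0)"
      by (intro sum.cong refl) (auto intro!: sum.neutral)
    also have "\<dots> = (\<Sum>l\<in>nbrs E b. ?p b l * f b l)" by simp
    also have "\<dots> = nb_mean E f a b"
      unfolding nb_mean_def
      by (rule sum.mono_neutral_cong_left) (auto simp: nb_prob_edge[OF ab] nbrs_def)
    finally show ?thesis by (simp add: e)
  qed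
  then show ?thesis by (simp add: vec_eq_iff matrix_vector_mult_def edge_vec_def)
qed

text \<open>Expectation under the stationary distribution on directed edges.\<close>

definition edge_avg :: "('v \<Rightarrow> 'v \<Rightarrow> real) \<Rightarrow> real" where
  "edge_avg f = (\<Sum>(a, b)\<in>directed_edges E. f a b) / (2 * real (num_edges E))"

lemma W_e_edge_vec: "W_e E *v edge_vec f = edge_vec (\<lambda>_ _. edge_avg f)"
proof -
  have "(\<Sum>e'\<in>UNIV. edge_vec f $ e' / (2 * real (num_edges E))) = edge_avg f"
    unfolding sum_divide_distrib[symmetric] edge_avg_def edge_vec_def by (simp add: sum_edge_vec)
  then show ?thesis
    by (simp add: vec_eq_iff matrix_vector_mult_def W_e_def stat_e_def edge_vec_def)
qed

abbreviation "fund \<equiv> mat 1 - P_nb E dedge + W_e E"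

lemma fund_edge_vec: "fund *v edge_vec f = edge_vec (\<lambda>a b. f a b - nb_mean E f a b + edge_avg f)"
  unfolding matrix_vector_mult_add_rdistrib matrix_vector_mult_diff_rdistrib
    P_nb_edge_vec W_e_edge_vec matrix_vector_mul_lid
  by (simp add: edge_vec_def vec_eq_iff)

lemma edge_avg_const: "edge_avg (\<lambda>_ _. k) = k"
  using num_edges_pos by (simp add: edge_avg_def card_directed_edges)

lemma edge_avg_nb_mean: "edge_avg (nb_mean E f) = edge_avg f"
  by (simp add: edge_avg_def sum_edges_nb_mean)

lemma edge_avg_add: "edge_avg (\<lambda>a b. f a b + g a b) = edge_avg f + edge_avg g"
  by (simp add: edge_avg_def case_prod_unfold sum.distrib add_divide_distrib)

lemma edge_avg_diff: "edge_avg (\<lambda>a b. f a b - g a b) = edge_avg f - edge_avg g"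
  by (simp add: edge_avg_def case_prod_unfold sum_subtractf diff_divide_distrib)

lemma edge_avg_cong: "(\<And>a b. E a b \<Longrightarrow> f a b = g a b) \<Longrightarrow> edge_avg f = edge_avg g"
  unfolding edge_avg_def by (intro arg_cong2[where f="(/)"] sum.cong) (auto simp: directed_edges_def)

text \<open>For \<open>f\<close> in the kernel, averaging \<open>f - P f + edge_avg f = 0\<close>
  gives \<open>edge_avg f = 0\<close> by stationarity. Then \<open>f\<close> is harmonic, hence
  constant, and equals its average 0.\<close>

lemma invertible_fund: "invertible fund"
  unfolding invertible_left_inverse matrix_left_invertible_ker
proof (intro allI impI)
  fix v assume v: "fund *v v = 0"
  obtain f where f: "v = edge_vec f" by (rule edge_vec_cases)
  have zero: "f a b - nb_mean E f a b + edge_avg f = 0" if "E a b" for a b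
  proof -
    have "(a, b) \<in> range dedge" using bij that by (simp add: bij_betw_def directed_edges_def)
    then obtain e where "dedge e = (a, b)" by (metis imageE)
    then show ?thesis using v unfolding f fund_edge_vec by (simp add: vec_eq_iff edge_vec_def) (metis fst_conv snd_conv)
  qed
  have "edge_avg f = edge_avg (\<lambda>a b. f a b - nb_mean E f a b + edge_avg f)"
    by (simp add: edge_avg_add edge_avg_diff edge_avg_nb_mean edge_avg_const)
  also have "\<dots> = edge_avg (\<lambda>_ _. 0)" by (rule edge_avg_cong) (rule zero)
  finally have avg: "edge_avg f = 0" by (simp add: edge_avg_const)
  then have "f a b \<le> nb_mean E f a b" if "E a b" for a b using zero[OF that] by simp
  then obtain k where k: "\<And>a b. E a b \<Longrightarrow> f a b = k" using nb_subharmonic_constant[of f] by metis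
  then have "edge_avg f = k" using edge_avg_cong[of f "\<lambda>_ _. k"] by (simp add: edge_avg_const)
  then have "v = edge_vec (\<lambda>_ _. 0)" unfolding f using avg k by (intro edge_vec_cong) simp
  then show "v = 0" by (simp add: edge_vec_def vec_eq_iff)
qed

lemma Z_e_fund: "Z_e E dedge *v (fund *v v) = v"
  unfolding matrix_vector_mul_assoc Z_e_def by (simp add: matrix_inv_inverse[OF invertible_fund])

text \<open>Both \<open>P_nb\<close> and \<open>W_e\<close> fix constants, hence so do
  \<open>fund\<close> and its inverse.\<close>

lemma Z_e_ones: "Z_e E dedge *v edge_vec (\<lambda>_ _. k) = edge_vec (\<lambda>_ _. k)"
  using Z_e_fund[of "edge_vec (\<lambda>_ _. k)"] by (simp add: fund_edge_vec nb_mean_const edge_avg_const)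

text \<open>The operator \<open>D^-1 T\<close>, one coordinate at a time.\<close>

definition out_avg :: "real^'e \<Rightarrow> 'v \<Rightarrow> real" where
  "out_avg v i = (T_mat dedge *v v) $ i / real (deg E i)"

lemma out_avg_edge_vec: "out_avg (edge_vec f) i = (\<Sum>y\<in>nbrs E i. f i y) / real (deg E i)"
proof -
  have "(T_mat dedge *v edge_vec f) $ i
      = (\<Sum>e\<in>UNIV. (\<lambda>a b. if a = i then f a b else 0) (fst (dedge e)) (snd (dedge e)))"
    by (simp add: matrix_vector_mult_def T_mat_def edge_vec_def) (intro sum.cong, auto)
  also have "\<dots> = (\<Sum>a\<in>UNIV. \<Sum>b\<in>nbrs E a. if a = i then f a b else 0)"
    by (rule trans[OF sum_edge_vec[of "\<lambda>a b. if a = i then f a b else 0"] sum_edges_out])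
  also have "\<dots> = (\<Sum>a\<in>UNIV. if a = i then (\<Sum>b\<in>nbrs E i. f i b) else 0)"
    by (intro sum.cong refl) (auto intro!: sum.neutral)
  finally show ?thesis by (simp add: out_avg_def)
qed

text \<open>Column \<open>j\<close> is read off by applying the product to a basis vector, which the
  transpose of \<open>T\<close> turns into the indicator of the edges leaving
  \<open>j\<close>.\<close>

lemma Z_v_eq: "Z_v E dedge $ i $ j = out_avg (Z_e E dedge *v edge_vec (\<lambda>a b. if a = j then 1 else 0)) i"
proof -
  let ?inv = "(\<chi> i j. if i = j then 1 / real (deg E i) else 0) :: real^'v^'v"
  have "?inv ** degree_matrix E = mat 1"
  proof -
    have "(\<Sum>k\<in>UNIV. ?inv $ i $ k * degree_matrix E $ k $ j)
        = (\<Sum>k\<in>UNIV. if k = i then (if i = j then 1 else 0) else 0)" for i j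
      using deg_pos[of i] by (intro sum.cong) (auto simp: degree_matrix_def)
    then show ?thesis by (simp add: vec_eq_iff matrix_matrix_mult_def mat_def)
  qed
  then have inv: "matrix_inv (degree_matrix E) = ?inv" by (rule matrix_inv_eqI)
  have scale: "(?inv *v u) $ i = u $ i / real (deg E i)" for u
  proof -
    have "(?inv *v u) $ i = (\<Sum>k\<in>UNIV. if k = i then u $ i / real (deg E i) else 0)"
      unfolding matrix_vector_mult_def vec_lambda_beta by (intro sum.cong) auto
    then show ?thesis by simp
  qed
  have "Z_v E dedge $ i $ j = (Z_v E dedge *v axis j 1) $ i"
    by (simp add: matrix_vector_mult_basis column_def)
  also have "Z_v E dedge *v axis j 1
      = ?inv *v (T_mat dedge *v (Z_e E dedge *v (transpose (T_mat dedge) *v axis j 1)))"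
    by (simp only: Z_v_def inv matrix_vector_mul_assoc matrix_mul_assoc)
  also have "transpose (T_mat dedge) *v axis j 1 = edge_vec (\<lambda>a b. if a = j then 1 else 0)"
    unfolding matrix_vector_mult_basis by (simp add: column_def transpose_def T_mat_def edge_vec_def)
  also have "(?inv *v (T_mat dedge *v w)) $ i = out_avg w i" for w
    by (simp add: scale out_avg_def)
  finally show ?thesis .
qed

lemma edge_avg_vertex: "edge_avg f = (\<Sum>k\<in>UNIV. stat_v E $ k * out_avg (edge_vec f) k)"
proof -
  have "(\<Sum>b\<in>nbrs E k. f k b) / (2 * real (num_edges E)) = stat_v E $ k * out_avg (edge_vec f) k" for k
    using deg_pos[of k] by (simp add: stat_v_def out_avg_edge_vec)
  then show ?thesis
    by (simp add: edge_avg_def sum_edges_out sum_divide_distrib[of _ UNIV])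
qed

section \<open>Hitting times through the fundamental matrix\<close>

definition hit :: "'v \<Rightarrow> 'v \<Rightarrow> 'v \<Rightarrow> real" where
  "hit j a b = (if a = j then 0 else mean_return E j a b)"

lemma hitting_matrix_eq: "hitting_matrix E $ i $ j = out_avg (edge_vec (hit j)) i"
proof -
  \<comment> \<open>\<open>enn2real\<close> inverts \<open>ennreal\<close> on nonnegative reals
    only.\<close>
  have "0 \<le> (\<Sum>y\<in>nbrs E i. hit j i y) / real (deg E i)"
    by (intro divide_nonneg_nonneg sum_nonneg) (auto simp: hit_def nbrs_def mean_return_nonneg)
  then show ?thesis
    by (simp add: hitting_matrix_def expected_hitting_time_eq out_avg_edge_vec flip: hit_def)
qed

lemma mean_return_locally_uniform:
  assumes unif: "locally_uniform_return_time E" and "E j y"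
  shows "mean_return E j j y = return_matrix E $ j $ j"
proof -
  have eq: "mean_return E j j z = mean_return E j j y" if "z \<in> nbrs E j" for z
  proof -
    have z: "E j z" using that by (simp add: nbrs_def)
    have "y \<in> nbrs E j" using \<open>E j y\<close> by (simp add: nbrs_def)
    with that unif have "expected_return_time_via E j z = expected_return_time_via E j y"
      unfolding locally_uniform_return_time_def by blast
    then show ?thesis
      using mean_return_nonneg[OF z] mean_return_nonneg[OF \<open>E j y\<close>]
      by (simp add: expected_return_time_via_eq z \<open>E j y\<close>)
  qed
  have "(\<Sum>z\<in>nbrs E j. mean_return E j j z) / real (deg E j) = mean_return E j j y"
    using eq deg_pos[of j] by (simp flip: deg_def)
  then show ?thesis
    using mean_return_nonneg[OF \<open>E j y\<close>] by (simp add: return_matrix_def expected_return_time_eq)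
qed

text \<open>Away from \<open>j\<close> this is the first-step equation. At \<open>a = j\<close> the
  left term is 0, while 1 plus the mean is the return time via \<open>b\<close>; local uniformity
  replaces it by a number independent of \<open>b\<close>.\<close>

lemma hit_equation:
  assumes unif: "locally_uniform_return_time E" and "E a b"
  shows "hit j a b - nb_mean E (hit j) a b = 1 - return_matrix E $ j $ j * (if a = j then 1 else 0)"
  using mean_return_step[OF \<open>E a b\<close>, of j] mean_return_locally_uniform[OF unif, of j b] \<open>E a b\<close>
  by (auto simp: hit_def[abs_def])

text \<open>Kac's formula, by averaging \<open>hit_equation\<close> over all directed edges: the
  left side vanishes by stationarity, and the edges leaving \<open>j\<close> have total weight
  \<open>stat_v E $ j\<close>.\<close>

lemma return_matrix_stat:
  assumes unif: "locally_uniform_return_time E"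
  shows "return_matrix E $ j $ j * stat_v E $ j = 1"
proof -
  let ?R = "return_matrix E $ j $ j"
  have ind: "edge_avg (\<lambda>a b. ?R * (if a = j then 1 else 0)) = ?R * stat_v E $ j"
  proof -
    have "(\<Sum>(a, b)\<in>directed_edges E. ?R * (if a = j then 1 else 0)) = (\<Sum>a\<in>UNIV. if a = j then ?R * real (deg E j) else 0)"
      unfolding sum_edges_out by (intro sum.cong refl) (simp add: deg_def)
    then show ?thesis by (simp add: edge_avg_def stat_v_def)
  qed
  have "0 = edge_avg (\<lambda>a b. hit j a b - nb_mean E (hit j) a b)"
    by (simp add: edge_avg_diff edge_avg_nb_mean)
  also have "\<dots> = edge_avg (\<lambda>a b. 1 - ?R * (if a = j then 1 else 0))"
    by (rule edge_avg_cong) (rule hit_equation[OF unif])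
  also have "\<dots> = 1 - ?R * stat_v E $ j"
    unfolding edge_avg_diff ind by (simp add: edge_avg_const)
  finally show ?thesis by simp
qed

text \<open>Adding the average of \<open>hit j\<close> to both sides of \<open>hit_equation\<close>
  turns \<open>I - P\<close> into \<open>fund\<close>. Applying \<open>Z_e\<close>, which fixes
  constants, and averaging over the edges leaving \<open>i\<close> gives the entry.\<close>

lemma hitting_matrix_Z_v:
  assumes unif: "locally_uniform_return_time E"
  shows "hitting_matrix E $ i $ j
    = 1 + edge_avg (hit j) - Z_v E dedge $ i $ j * return_matrix E $ j $ j"
proof -
  let ?R = "return_matrix E $ j $ j" and ?k = "1 + edge_avg (hit j)"
  let ?ind = "edge_vec (\<lambda>a b. if a = j then 1 else 0)"
  have "fund *v edge_vec (hit j) = edge_vec (\<lambda>_ _. ?k) - ?R *\<^sub>R ?ind"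
    unfolding fund_edge_vec using hit_equation[OF unif edge_dedge, where j = j]
    by (simp add: vec_eq_iff edge_vec_def)
  then have "edge_vec (hit j) = edge_vec (\<lambda>_ _. ?k) - ?R *\<^sub>R (Z_e E dedge *v ?ind)"
    using Z_e_fund[of "edge_vec (hit j)"]
    by (simp add: matrix_vector_mult_diff_distrib matrix_vector_mult_scaleR Z_e_ones)
  then have "hitting_matrix E $ i $ j = out_avg (edge_vec (\<lambda>_ _. ?k)) i - ?R * out_avg (Z_e E dedge *v ?ind) i"
    unfolding hitting_matrix_eq
    by (simp add: out_avg_def matrix_vector_mult_diff_distrib matrix_vector_mult_scaleR diff_divide_distrib)
  also have "out_avg (edge_vec (\<lambda>_ _. ?k)) i = ?k"
    using deg_pos[of i] by (simp add: out_avg_edge_vec flip: deg_def)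
  finally show ?thesis by (simp add: Z_v_eq)
qed

end

theorem mainTheorem7:
  fixes E :: "'v::finite \<Rightarrow> 'v \<Rightarrow> bool"
    and dedge :: "'e::finite \<Rightarrow> 'v \<times> 'v"
  assumes "simple_graph E"
    and "connected_graph E"
    and "\<forall>i. deg E i \<ge> 2"
    and "\<not> is_cycle_graph E"
    and "bij_betw dedge UNIV (directed_edges E)"
    and "locally_uniform_return_time E"
  shows "invertible (mat 1 - P_nb E dedge + W_e E) \<and>
    (\<forall>i j. expected_hitting_time E i j < \<infinity>) \<and>
    (\<forall>i. expected_return_time E i < \<infinity>) \<and>
    hitting_matrix E = all_ones - Z_v E dedge ** return_matrix E + W_v E ** hitting_matrix E \<and>
    (\<forall>i j. hitting_matrix E $ i $ j = (Z_v E dedge $ j $ j - Z_v E dedge $ i $ j) / stat_v E $ j)"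
proof -
  interpret nb_edge_matrices E dedge
    using assms(1-5) by unfold_locales
  note M = hitting_matrix_Z_v[OF assms(6)]
  have "(Z_v E dedge ** return_matrix E) $ i $ j = Z_v E dedge $ i $ j * return_matrix E $ j $ j" for i j
    by (simp add: matrix_matrix_mult_def return_matrix_def if_distrib cong: if_cong)
  \<comment> \<open>All rows of \<open>W_v\<close> are the stationary vector, so the entry is the
    stationary mean of column \<open>j\<close>, that is, an edge average.\<close>
  moreover have "(W_v E ** hitting_matrix E) $ i $ j = edge_avg (hit j)" for i j
    by (simp add: matrix_matrix_mult_def W_v_def hitting_matrix_eq edge_avg_vertex)
  ultimately have "hitting_matrix E = all_ones - Z_v E dedge ** return_matrix E + W_v E ** hitting_matrix E"
    by (simp add: vec_eq_iff all_ones_def M)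
  moreover have "hitting_matrix E $ i $ j = (Z_v E dedge $ j $ j - Z_v E dedge $ i $ j) / stat_v E $ j" for i j
  proof -
    have "hitting_matrix E $ j $ j = 0"
      by (simp add: hitting_matrix_eq out_avg_edge_vec hit_def)
    \<comment> \<open>The zero diagonal entry expresses the unknown
      \<open>1 + edge_avg (hit j)\<close> as the diagonal entry of \<open>Z_v\<close> times the
      return time.\<close>
    then have "hitting_matrix E $ i $ j = (Z_v E dedge $ j $ j - Z_v E dedge $ i $ j) * return_matrix E $ j $ j"
      using M[of i j] M[of j j] by (simp add: left_diff_distrib)
    moreover have "return_matrix E $ j $ j = 1 / stat_v E $ j"
      using return_matrix_stat[OF assms(6), of j] by (metis mult_zero_right nonzero_eq_divide_eq zero_neq_one)
    ultimately show ?thesis by simp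
  qed
  ultimately show ?thesis
    using invertible_fund by (simp add: expected_hitting_time_eq expected_return_time_eq)
qed

end
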